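(* Let $f:\mathbb{R}\to\mathbb{R}$ be continuous with $f(0)=0$ and $xf(x)>0$ for all $x\neq 0$. Suppose that there exists an odd function $\phi$ on $\mathbb{R}$ such that $\lim_{x\to 0} f(x)/\phi(x)=1$, that $f\in \mathrm{RV}_0(\beta)$ for some $\beta>1$, and that $\lim_{x\to 0^+} f(x)/x=0$. Let $g:[0,\infty)\to\mathbb{R}$ be continuous, and let $x$ be a continuous solution on $[0,\infty)$ of $$x'(t)=-f(x(t))+g(t),\quad t>0;\qquad x(0)=\xi\in\mathbb{R},$$ which obeys $\lim_{t\to\infty}x(t)=0$. Then the following are equivalent: (a) $\lim_{t\to\infty}\int_0^t g(s)\,ds$ exists and is finite, and $$\lim_{t\to\infty}\frac{\int_t^\infty g(s)\,ds}{F^{-1}(t)}=0;$$ (b) there exists $\lambda\in\{-1,0,1\}$ such that $$\lim_{t\to\infty}\frac{x(t)}{F^{-1}(t)}=\lambda.$$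
   Context: A function $f$ which is positive and measurable on $(0,\infty)$ is regularly varying at $0$ with index $\beta\in\mathbb{R}$, written $f\in\mathrm{RV}_0(\beta)$, if $\lim_{x\to0^+} f(\lambda x)/f(x)=\lambda^\beta$ for every $\lambda>0$ (for $f$ defined on $\mathbb{R}$ this refers to its restriction to $(0,\infty)$). Define $F(x)=\int_x^1 \frac{1}{f(u)}\,du$ for $x>0$. $F$ is strictly decreasing; since $\beta>1$, $F(x)\to\infty$ as $x\to0^+$. $F^{-1}$ denotes the inverse function of $F$; $F^{-1}(t)>0$ is defined for all $t\ge 0$ and tends to $0$ as $t\to\infty$. When $\lim_{T\to\infty}\int_0^T g(s)\,ds$ exists and is finite, $\int_t^\infty g(s)\,ds:=\lim_{T\to\infty}\int_0^T g(s)\,ds-\int_0^t g(s)\,ds$ (no absolute integrability is assumed). *)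

theory Defs
  imports "HOL-Analysis.Analysis"
begin

definition regularly_varying_at_0 :: "(real \<Rightarrow> real) \<Rightarrow> real \<Rightarrow> bool" where
  "regularly_varying_at_0 f \<beta> \<longleftrightarrow>
     (\<forall>x>0. f x > 0) \<and>
     f \<in> borel_measurable (lebesgue_on {0<..}) \<and>
     (\<forall>l>0. ((\<lambda>x. f (l * x) / f x) \<longlongrightarrow> l powr \<beta>) (at_right 0))"

text \<open>
  The interval integral is oriented, so for \<open>x > 1\<close> the value is minus the integral
  over \<open>[1, x]\<close>.
\<close>

definition F :: "(real \<Rightarrow> real) \<Rightarrow> real \<Rightarrow> real" where
  "F f x = (LBINT u=ereal x..1. 1 / f u)"

text \<open>
  The inverse of \<open>F f\<close> as a map on the positive half-line. It is meaningful only at values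
  attained by \<open>F f\<close> there, and when \<open>F f\<close> is injective there.
\<close>

definition F_inv :: "(real \<Rightarrow> real) \<Rightarrow> real \<Rightarrow> real" where
  "F_inv f = the_inv_into {0<..} (F f)"

text \<open>
  The conditionally convergent integral of \<open>g\<close> over \<open>[t, \<infinity>)\<close>. It is meaningful only
  when the limit exists.
\<close>

definition tail_integral :: "(real \<Rightarrow> real) \<Rightarrow> real \<Rightarrow> real" where
  "tail_integral g t =
     Lim at_top (\<lambda>T. LBINT s=0..ereal T. g s) - (LBINT s=0..ereal t. g s)"

end

theory Submission
  imports Defs
begin

text \<open>
  The function \<open>y = F_inv f\<close> solves \<open>y' = - f y\<close>, is positive and decreases to zero, so the theorem
  compares a perturbed solution \<open>x\<close> with an unperturbed one. Both directions rest on a single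
  property of \<open>f\<close>: as \<open>y \<rightarrow> 0+\<close> and \<open>u \<rightarrow> v\<close> jointly, \<open>f(yu)/f(y)\<close> tends to \<open>sgn v * |v| powr \<beta>\<close>, for
  every real \<open>v\<close> (\<open>RV_quotient_tendsto\<close>). Regular variation gives this for fixed \<open>u > 0\<close>; continuity
  of \<open>f\<close> and the Baire category theorem upgrade it to Potter bounds (\<open>Potter_bound\<close>), which yield the
  joint limit, and comparison with the odd function \<open>\<phi>\<close> extends it to negative arguments. The fixed
  points of the limit function are exactly \<open>-1\<close>, \<open>0\<close> and \<open>1\<close>, since \<open>\<beta> > 1\<close>.

  Suppose that the tail \<open>h(t)\<close> of the integral of \<open>g\<close> is \<open>o(y)\<close>. Then \<open>x + h\<close> has derivative
  \<open>- f(x)\<close>, and \<open>w = (x + h)/y\<close> satisfies \<open>w' = (f(y)/y) (w - f(x)/f(y))\<close> with \<open>x/y = w + o(1)\<close>. In the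
  time \<open>s = - ln y\<close>, which tends to infinity, this is asymptotically the autonomous equation
  \<open>dw/ds = w - sgn w * |w| powr \<beta>\<close>. A scalar equation of this kind lets \<open>w\<close> cross each
  non-equilibrium value in one direction only, which forces \<open>w\<close> to converge to an equilibrium
  (\<open>asymptotically_autonomous_convergence\<close>); escape to infinity is excluded because \<open>f(yu)/f(y)\<close> grows
  superlinearly in \<open>u\<close> (\<open>RV_quotient_growth\<close>).

  Conversely, if \<open>x/y \<rightarrow> \<lambda>\<close> for one of the three values, then \<open>f(x)/f(y) \<rightarrow> \<lambda>\<close>. With \<open>G\<close> the integral of
  \<open>g\<close>, the function \<open>G - x\<close> has derivative \<open>f(x)\<close>, so by L'Hospital (\<open>LHospital_at_top_0_over_0\<close>) it
  converges and its tail is \<open>\<lambda> y + o(y)\<close>. The tail of \<open>G\<close> is that tail minus \<open>x\<close>, hence \<open>o(y)\<close>.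
\<close>

section \<open>Uniform convergence and Potter bounds\<close>

text \<open>
  This is the uniform convergence theorem for slowly varying functions, in additive form. For
  continuous \<open>k\<close> the sets on which the convergence is already good after time \<open>n\<close> are closed and
  exhaust \<open>[0,1]\<close>, so by Baire one of them contains an interval. Translating that interval back to
  the origin gives uniformity on \<open>[0, \<eta>]\<close>, and finitely many translates of \<open>[0, \<eta>]\<close> cover \<open>[0,1]\<close>.
\<close>

lemma slowly_varying_uniform:
  fixes k :: "real \<Rightarrow> real"
  assumes cont: "continuous_on UNIV k"
    and lim: "\<And>u. ((\<lambda>s. k (s + u) - k s) \<longlongrightarrow> 0) at_top"
    and \<epsilon>: "\<epsilon> > 0"
  shows "\<exists>X. \<forall>s\<ge>X. \<forall>u\<in>{0..1}. \<bar>k (s + u) - k s\<bar> \<le> \<epsilon>"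
proof -
  have ev: "\<forall>\<^sub>F s in at_top. \<bar>k (s + u) - k s\<bar> \<le> c" if "c > 0" for u c
    using tendstoD[OF lim[of u] that] by eventually_elim (simp add: dist_real_def)
  define E where "E n = {0..1} \<inter> (\<Inter>s\<in>{real n..}. {u. \<bar>k (s + u) - k s\<bar> \<le> \<epsilon> / 4})" for n :: nat
  have closed_E: "closed (E n)" for n
  proof -
    have "continuous_on UNIV (\<lambda>u. \<bar>k (s + u) - k s\<bar>)" for s
      by (intro continuous_intros continuous_on_compose2[OF cont]) auto
    then show ?thesis
      unfolding E_def by (intro closed_Int closed_INT ballI closed_Collect_le continuous_on_const closed_atLeastAtMost)
  qed
  have "{0..1} \<subseteq> (\<Union>n. E n)"
  proof
    fix u :: real assume u: "u \<in> {0..1}"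
    have "\<forall>\<^sub>F s in at_top. \<bar>k (s + u) - k s\<bar> \<le> \<epsilon> / 4"
      by (rule ev) (use \<epsilon> in simp)
    then obtain N where N: "\<And>s. s \<ge> N \<Longrightarrow> \<bar>k (s + u) - k s\<bar> \<le> \<epsilon> / 4"
      by (auto simp: eventually_at_top_linorder)
    obtain n where "real n \<ge> N" using real_arch_simple by blast
    then have "u \<in> E n" using u N by (auto simp: E_def)
    then show "u \<in> (\<Union>n. E n)" by blast
  qed
  then have "{0<..<1} \<subseteq> interior (\<Union>n. E n)"
    by (intro interior_maximal) (auto simp: subset_iff)
  then have "interior (\<Union>n. E n) \<noteq> {}"
    by (metis dense_order_class.dense greaterThanLessThan_iff subsetD empty_iff zero_less_one)
  then obtain n where "interior (E n) \<noteq> {}"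
    using Baire_category_alt[of "euclidean :: real topology" "range E"] closed_E
      completely_metrizable_space_euclidean by fastforce
  then obtain a \<eta> where \<eta>: "\<eta> > 0" and ball: "cball a \<eta> \<subseteq> E n"
    by (meson all_not_in_conv mem_interior_cball)
  (* Two translations from the common base point s - a compare k at s and at s + u. *)
  have small: "\<bar>k (s + u) - k s\<bar> \<le> \<epsilon> / 2" if "s \<ge> real n + 1" "0 \<le> u" "u \<le> \<eta>" for s u
  proof -
    have "a \<in> E n" "a + u \<in> E n"
      using ball \<eta> that by (auto simp: subset_iff dist_real_def)
    moreover from this have "s - a \<ge> real n" using that by (auto simp: E_def)
    ultimately have "\<bar>k (s - a + a) - k (s - a)\<bar> \<le> \<epsilon> / 4"
      "\<bar>k (s - a + (a + u)) - k (s - a)\<bar> \<le> \<epsilon> / 4"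
      unfolding E_def by blast+
    then have "\<bar>k s - k (s - a)\<bar> \<le> \<epsilon> / 4" "\<bar>k (s + u) - k (s - a)\<bar> \<le> \<epsilon> / 4"
      by (simp_all add: algebra_simps)
    then show ?thesis by linarith
  qed
  (* The finitely many grid points j * \<eta> reach up to 1, and pointwise convergence is
     uniform on a finite set. *)
  obtain N :: nat where N: "1 / \<eta> \<le> real N" using real_arch_simple by blast
  have "\<forall>\<^sub>F s in at_top. \<forall>j\<in>{..N}. \<bar>k (s + real j * \<eta>) - k s\<bar> \<le> \<epsilon> / 2"
    by (intro eventually_ball_finite ballI ev) (use \<epsilon> in auto)
  then obtain X where X: "\<And>s j. s \<ge> X \<Longrightarrow> j \<le> N \<Longrightarrow> \<bar>k (s + real j * \<eta>) - k s\<bar> \<le> \<epsilon> / 2"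
    by (auto simp: eventually_at_top_linorder)
  have "\<bar>k (s + u) - k s\<bar> \<le> \<epsilon>" if s: "s \<ge> max X (real n + 1)" and u: "u \<in> {0..1}" for s u
  proof -
    define j where "j = nat \<lfloor>u / \<eta>\<rfloor>"
    have j1: "real j \<le> u / \<eta>" and j2: "u / \<eta> < real j + 1"
      using u \<eta> unfolding j_def by (auto simp: of_nat_nat)
    have "real j \<le> 1 / \<eta>"
      using j1 u \<eta> by (smt (verit) atLeastAtMost_iff divide_right_mono)
    then have "j \<le> N" using N by linarith
    moreover have "0 \<le> u - j * \<eta>" "u - j * \<eta> \<le> \<eta>"
      using j1 j2 \<eta> by (auto simp: field_simps)
    moreover have "s + j * \<eta> \<ge> real n + 1" using s \<eta> by (simp add: add_increasing2)
    ultimately have "\<bar>k (s + real j * \<eta>) - k s\<bar> \<le> \<epsilon> / 2"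
      "\<bar>k (s + real j * \<eta> + (u - real j * \<eta>)) - k (s + real j * \<eta>)\<bar> \<le> \<epsilon> / 2"
      using X[of s j] s small[of "s + real j * \<eta>" "u - real j * \<eta>"] by linarith+
    moreover have "s + real j * \<eta> + (u - real j * \<eta>) = s + u" by simp
    ultimately show ?thesis by (smt (verit) field_sum_of_halves)
  qed
  then show ?thesis by blast
qed

text \<open>
  Chaining unit steps turns the uniform bound on one unit interval into a bound valid for all
  increments at once, at the cost of a slope \<open>\<epsilon>\<close>.
\<close>

lemma slowly_varying_linear_growth:
  fixes k :: "real \<Rightarrow> real"
  assumes cont: "continuous_on UNIV k"
    and lim: "\<And>u. ((\<lambda>s. k (s + u) - k s) \<longlongrightarrow> 0) at_top"
    and \<epsilon>: "\<epsilon> > 0"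
  shows "\<exists>X. \<forall>s\<ge>X. \<forall>u\<ge>0. \<bar>k (s + u) - k s\<bar> \<le> \<epsilon> * (1 + u)"
proof -
  obtain X where X: "\<And>s u. s \<ge> X \<Longrightarrow> 0 \<le> u \<Longrightarrow> u \<le> 1 \<Longrightarrow> \<bar>k (s + u) - k s\<bar> \<le> \<epsilon>"
    using slowly_varying_uniform[OF assms] by (metis atLeastAtMost_iff)
  have step: "\<bar>k (s + real n) - k s\<bar> \<le> \<epsilon> * real n" if "s \<ge> X" for s n
  proof (induction n)
    case (Suc n)
    have "\<bar>k (s + real n + 1) - k (s + real n)\<bar> \<le> \<epsilon>"
      using X[of "s + real n" 1] that by simp
    with Suc show ?case by (simp add: algebra_simps)
  qed simp
  have "\<bar>k (s + u) - k s\<bar> \<le> \<epsilon> * (1 + u)" if s: "s \<ge> X" and u: "u \<ge> 0" for s u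
  proof -
    define n where "n = nat \<lfloor>u\<rfloor>"
    have n: "real n \<le> u" "u \<le> real n + 1" using u unfolding n_def by (auto simp: of_nat_nat)
    have "\<bar>k (s + real n + (u - real n)) - k (s + real n)\<bar> \<le> \<epsilon>"
      using X[of "s + real n" "u - real n"] s n by simp
    moreover have "\<epsilon> * real n \<le> \<epsilon> * u" using n \<epsilon> by simp
    ultimately show ?thesis using step[OF s, of n] by (simp add: algebra_simps)
  qed
  then show ?thesis by blast
qed

text \<open>
  In the coordinates \<open>s = - ln x\<close> the function \<open>k(s) = ln f(x) - \<beta> ln x\<close> satisfies
  \<open>k(s + u) - k(s) \<rightarrow> 0\<close>, so the linear growth bound for \<open>k\<close> is the Potter bound for \<open>f\<close>. Stating it
  with absolute values of logarithms keeps it symmetric in \<open>a\<close> and \<open>b\<close>.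
\<close>

lemma Potter_bound:
  assumes RV: "regularly_varying_at_0 f \<beta>" and cont: "continuous_on {0<..} f" and \<delta>: "\<delta> > 0"
  shows "\<exists>x0>0. \<forall>a\<in>{0<..x0}. \<forall>b\<in>{0<..x0}.
           \<bar>ln (f b / f a) - \<beta> * ln (b / a)\<bar> \<le> \<delta> * (1 + \<bar>ln (b / a)\<bar>)"
proof -
  have pos: "f x > 0" if "x > 0" for x using RV that by (auto simp: regularly_varying_at_0_def)
  define k where "k s = ln (f (exp (- s))) + \<beta> * s" for s
  have "continuous_on UNIV k"
    unfolding k_def
    by (intro continuous_intros continuous_on_compose2[OF cont]) (use pos in \<open>auto simp: less_imp_neq[symmetric]\<close>)
  moreover have "((\<lambda>s. k (s + u) - k s) \<longlongrightarrow> 0) at_top" for u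
  proof -
    have "((\<lambda>x. f (exp (- u) * x) / f x) \<longlongrightarrow> exp (- u) powr \<beta>) (at_right 0)"
      using RV by (auto simp: regularly_varying_at_0_def)
    moreover have "filterlim (\<lambda>s::real. exp (- s)) (at_right 0) at_top"
      unfolding filterlim_at
      by (auto intro!: filterlim_compose[OF exp_at_bot filterlim_uminus_at_bot_at_top])
    ultimately have "((\<lambda>s. f (exp (- u) * exp (- s)) / f (exp (- s))) \<longlongrightarrow> exp (- u) powr \<beta>) at_top"
      by (rule filterlim_compose)
    then have "((\<lambda>s. ln (f (exp (- u) * exp (- s)) / f (exp (- s))) + \<beta> * u)
                 \<longlongrightarrow> ln (exp (- u) powr \<beta>) + \<beta> * u) at_top"
      by (intro tendsto_intros) auto
    moreover have "ln (f (exp (- u) * exp (- s)) / f (exp (- s))) + \<beta> * u = k (s + u) - k s" for s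
    proof -
      have "exp (- (s + u)) = exp (- u) * exp (- s)" by (simp add: exp_add[symmetric])
      then show ?thesis
        using pos[of "exp (- s)"] pos[of "exp (- u) * exp (- s)"]
        by (simp add: k_def ln_div algebra_simps)
    qed
    ultimately show ?thesis by (simp add: powr_def)
  qed
  ultimately obtain X where X: "\<And>s u. s \<ge> X \<Longrightarrow> u \<ge> 0 \<Longrightarrow> \<bar>k (s + u) - k s\<bar> \<le> \<delta> * (1 + u)"
    using slowly_varying_linear_growth \<delta> by metis
  have ordered: "\<bar>ln (f b / f a) - \<beta> * ln (b / a)\<bar> \<le> \<delta> * (1 + \<bar>ln (b / a)\<bar>)"
    if "0 < b" "b \<le> a" "a \<le> exp (- X)" for a b
  proof -
    have "ln a \<le> - X" using that ln_le_cancel_iff[of a "exp (- X)"] by simp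
    moreover have "ln b \<le> ln a" using that by simp
    ultimately have "\<bar>k (- ln a + (ln a - ln b)) - k (- ln a)\<bar> \<le> \<delta> * (1 + (ln a - ln b))"
      by (intro X) auto
    then show ?thesis
      using that pos[of a] pos[of b] \<open>ln b \<le> ln a\<close> by (simp add: k_def ln_div algebra_simps)
  qed
  have "\<bar>ln (f b / f a) - \<beta> * ln (b / a)\<bar> \<le> \<delta> * (1 + \<bar>ln (b / a)\<bar>)"
    if "a \<in> {0<..exp (- X)}" "b \<in> {0<..exp (- X)}" for a b
  proof (cases "b \<le> a")
    case True
    then show ?thesis using ordered that by auto
  next
    case False
    then have "\<bar>ln (f a / f b) - \<beta> * ln (a / b)\<bar> \<le> \<delta> * (1 + \<bar>ln (a / b)\<bar>)"
      using ordered[of a b] that by auto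
    moreover have "ln (f a / f b) = - ln (f b / f a)" "ln (a / b) = - ln (b / a)"
      using that pos[of a] pos[of b] by (auto simp: ln_div)
    ultimately show ?thesis by simp
  qed
  then show ?thesis by (intro exI[of _ "exp (- X)"]) auto
qed

section \<open>Asymptotically autonomous scalar equations\<close>

text \<open>
  If \<open>w b < v\<close>, then at the last time before \<open>b\<close> at which \<open>w \<ge> v\<close>, the function would have to be at \<open>v\<close>, where its
  derivative pushes it upwards, so that it stays above \<open>v\<close> a little longer.
\<close>

lemma upward_barrier:
  fixes w w' :: "real \<Rightarrow> real"
  assumes der: "\<And>t. t \<ge> a \<Longrightarrow> (w has_real_derivative w' t) (at t)"
    and push: "\<And>t. t \<ge> a \<Longrightarrow> w t = v \<Longrightarrow> w' t > 0"
    and "w a \<ge> v" and "b \<ge> a"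
  shows "w b \<ge> v"
proof (rule ccontr)
  assume b: "\<not> w b \<ge> v"
  have cont: "continuous_on {a..b} w"
    using der by (intro DERIV_continuous_on) (auto intro: has_field_derivative_at_within)
  define S where "S = {t\<in>{a..b}. v \<le> w t}"
  have "compact S"
  proof -
    have "closed S" unfolding S_def
      using continuous_closedin_preimage[OF cont, of "{v..}"]
        continuous_closed_preimage[OF cont, of "{v..}"] by (simp add: vimage_def Int_def)
    moreover have "bounded S" by (rule bounded_subset[of "{a..b}"]) (auto simp: S_def)
    ultimately show ?thesis by (simp add: compact_eq_bounded_closed)
  qed
  moreover have "a \<in> S" using assms by (auto simp: S_def)
  ultimately obtain s where s: "s \<in> S" and last: "\<And>t. t \<in> S \<Longrightarrow> t \<le> s"
    using compact_attains_sup[of S] by auto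
  have s': "a \<le> s" "s < b" "v \<le> w s" using s b by (auto simp: S_def less_le)
  have "\<exists>d>0. \<forall>h>0. h < d \<longrightarrow> v < w (s + h)"
  proof (cases "w s = v")
    case True
    then show ?thesis using DERIV_pos_inc_right[OF der push] s' by metis
  next
    case False
    then have "v < w s" using s' by simp
    moreover have "isCont w s" using der s' by (metis DERIV_isCont)
    ultimately have "\<forall>\<^sub>F t in at s. v < w t"
      by (auto simp: isCont_def intro: order_tendstoD)
    then obtain d where "d > 0" "\<And>t. t \<noteq> s \<Longrightarrow> dist t s < d \<Longrightarrow> v < w t"
      by (auto simp: eventually_at)
    then show ?thesis by (intro exI[of _ d]) (auto simp: dist_real_def)
  qed
  then obtain d where d: "d > 0" "\<And>h. 0 < h \<Longrightarrow> h < d \<Longrightarrow> v < w (s + h)" by blast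
  define h where "h = min (d / 2) (b - s)"
  have "0 < h" "h < d" "s + h \<le> b" using d s' by (auto simp: h_def)
  then have "s + h \<in> S" using d(2)[of h] s' by (auto simp: S_def)
  then show False using last[of "s + h"] \<open>0 < h\<close> by simp
qed

lemma eventually_one_sided:
  fixes w p R :: "real \<Rightarrow> real"
  assumes der: "\<forall>\<^sub>F t in at_top. (w has_real_derivative p t * R t) (at t)"
    and p: "\<forall>\<^sub>F t in at_top. p t > 0"
    and R: "\<forall>\<^sub>F t in at_top. w t = v \<longrightarrow> R t > 0"
  shows "(\<forall>\<^sub>F t in at_top. w t \<ge> v) \<or> (\<forall>\<^sub>F t in at_top. w t \<le> v)"
proof -
  have "\<forall>\<^sub>F t in at_top. (w has_real_derivative p t * R t) (at t) \<and> (w t = v \<longrightarrow> p t * R t > 0)"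
    using der p R by eventually_elim auto
  then obtain T where T: "\<And>t. t \<ge> T \<Longrightarrow> (w has_real_derivative p t * R t) (at t)"
    "\<And>t. t \<ge> T \<Longrightarrow> w t = v \<Longrightarrow> p t * R t > 0"
    by (auto simp: eventually_at_top_linorder)
  show ?thesis
  proof (cases "\<exists>a\<ge>T. w a \<ge> v")
    case True
    then obtain a where "a \<ge> T" "w a \<ge> v" by blast
    then have "\<forall>t\<ge>a. w t \<ge> v"
      using upward_barrier[of a w "\<lambda>t. p t * R t" v] T by auto
    then show ?thesis by (auto simp: eventually_at_top_linorder)
  next
    case False
    then have "\<forall>t\<ge>T. w t \<le> v" by auto
    then show ?thesis by (auto simp: eventually_at_top_linorder)
  qed
qed

text \<open>
  In the time scale \<open>P\<close> the equation reads \<open>dw/dP = R\<close>, and the \<open>push\<close> hypothesis says that \<open>R\<close> is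
  eventually of one sign, and bounded away from zero, near each value outside the exceptional set
  \<open>E\<close> of equilibria. Such a value can be crossed in one direction only, so \<open>w\<close> ends up on one side
  of it. As the non-equilibrium values are dense, \<open>w\<close> has a limit, which is finite by the sign
  conditions for large \<open>|w|\<close>. The limit must lie in \<open>E\<close>: otherwise \<open>w\<close> would drift at a positive
  rate for an infinite amount of \<open>P\<close>-time.
\<close>

lemma asymptotically_autonomous_convergence:
  fixes w p R P :: "real \<Rightarrow> real"
  assumes der: "\<forall>\<^sub>F t in at_top. (w has_real_derivative p t * R t) (at t)"
    and p: "\<forall>\<^sub>F t in at_top. p t > 0"
    and P: "\<forall>\<^sub>F t in at_top. (P has_real_derivative p t) (at t)"
    and P_top: "filterlim P at_top at_top"
    and fin: "finite E"
    and push: "\<And>v. v \<notin> E \<Longrightarrow> \<exists>\<sigma>\<in>{-1, 1}. \<exists>r>0. \<exists>\<epsilon>>0. \<forall>\<^sub>F t in at_top. \<bar>w t - v\<bar> < \<epsilon> \<longrightarrow> \<sigma> * R t \<ge> r"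
    and above: "\<forall>\<^sub>F t in at_top. w t \<ge> M \<longrightarrow> R t \<le> 0"
    and below: "\<forall>\<^sub>F t in at_top. w t \<le> - M \<longrightarrow> R t \<ge> 0"
  shows "\<exists>l\<in>E. (w \<longlongrightarrow> l) at_top"
proof -
  have one_sided: "(\<forall>\<^sub>F t in at_top. w t \<ge> v) \<or> (\<forall>\<^sub>F t in at_top. w t \<le> v)" if v: "v \<notin> E" for v
  proof -
    obtain \<sigma> r \<epsilon> where *: "\<sigma> \<in> {-1, 1}" "r > 0" "\<epsilon> > 0"
      "\<forall>\<^sub>F t in at_top. \<bar>w t - v\<bar> < \<epsilon> \<longrightarrow> \<sigma> * R t \<ge> r" using push[OF v] by blast
    have **: "\<forall>\<^sub>F t in at_top. w t = v \<longrightarrow> \<sigma> * R t > 0"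
      using *(4) by eventually_elim (use * in auto)
    show ?thesis
    proof (cases "\<sigma> = 1")
      case True
      then show ?thesis using eventually_one_sided[OF der p, of v] ** by simp
    next
      case False
      have "\<forall>\<^sub>F t in at_top. ((\<lambda>t. - w t) has_real_derivative p t * (- R t)) (at t)"
        using der by eventually_elim (auto intro: DERIV_minus)
      moreover have "\<forall>\<^sub>F t in at_top. - w t = - v \<longrightarrow> - R t > 0"
        using ** False * by auto
      ultimately show ?thesis using eventually_one_sided[of "\<lambda>t. - w t" p "\<lambda>t. - R t" "- v"] p by auto
    qed
  qed
  have dense: "\<exists>c. c \<notin> E \<and> a < c \<and> c < b" if "a < b" for a b
  proof -
    have "infinite ({a<..<b} - E)" using fin that by (simp add: infinite_Ioo)
    then obtain c where "c \<in> {a<..<b} - E" by (metis all_not_in_conv finite.emptyI)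
    then show ?thesis by auto
  qed
  have bounded_above: "\<exists>K. \<forall>\<^sub>F t in at_top. w t \<le> K"
  proof -
    obtain c where c: "c \<notin> E" "M < c" using dense[of M "M + 1"] by auto
    from one_sided[OF c(1)] show ?thesis
    proof
      assume "\<forall>\<^sub>F t in at_top. w t \<ge> c"
      with der p above have "\<forall>\<^sub>F t in at_top. \<exists>d. (w has_real_derivative d) (at t) \<and> d \<le> 0"
        by eventually_elim (use c in \<open>auto intro!: exI mult_nonneg_nonpos\<close>)
      then obtain T where T: "\<And>t. t \<ge> T \<Longrightarrow> \<exists>d. (w has_real_derivative d) (at t) \<and> d \<le> 0"
        by (auto simp: eventually_at_top_linorder)
      have "w t \<le> w T" if "t \<ge> T" for t
        by (rule DERIV_nonpos_imp_nonincreasing[OF that]) (rule T)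
      then show ?thesis by (auto simp: eventually_at_top_linorder)
    qed blast
  qed
  have bounded_below: "\<exists>K. \<forall>\<^sub>F t in at_top. K \<le> w t"
  proof -
    obtain c where c: "c \<notin> E" "c < - M" using dense[of "- M - 1" "- M"] by auto
    from one_sided[OF c(1)] show ?thesis
    proof
      assume "\<forall>\<^sub>F t in at_top. w t \<le> c"
      with der p below have "\<forall>\<^sub>F t in at_top. \<exists>d. (w has_real_derivative d) (at t) \<and> d \<ge> 0"
        by eventually_elim (use c in \<open>auto intro!: exI mult_nonneg_nonneg\<close>)
      then obtain T where T: "\<And>t. t \<ge> T \<Longrightarrow> \<exists>d. (w has_real_derivative d) (at t) \<and> d \<ge> 0"
        by (auto simp: eventually_at_top_linorder)
      have "w T \<le> w t" if "t \<ge> T" for t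
        by (rule DERIV_nonneg_imp_nondecreasing[OF that]) (rule T)
      then show ?thesis by (auto simp: eventually_at_top_linorder)
    qed blast
  qed
  (* The limit is the lower limit of w: a value c above it is not an eventual lower bound, so
     one-sidedness at c makes c an eventual upper bound. *)
  define S where "S = {v. \<forall>\<^sub>F t in at_top. v \<le> w t}"
  obtain K where K: "\<forall>\<^sub>F t in at_top. w t \<le> K" using bounded_above by blast
  have S_le: "v \<le> K" if "v \<in> S" for v
  proof -
    have "\<forall>\<^sub>F t in at_top::real filter. v \<le> K"
      using K that unfolding S_def mem_Collect_eq by eventually_elim simp
    then show ?thesis by simp
  qed
  have S_ne: "S \<noteq> {}" using bounded_below by (auto simp: S_def)
  define l where "l = Sup S"
  have lim: "(w \<longlongrightarrow> l) at_top"
  proof (rule order_tendstoI)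
    fix v assume "v < l"
    then obtain u where "u \<in> S" "v < u" using S_ne unfolding l_def by (meson less_cSupE)
    then show "\<forall>\<^sub>F t in at_top. v < w t" by (auto simp: S_def elim: eventually_mono)
  next
    fix v assume "l < v"
    then obtain c where c: "c \<notin> E" "l < c" "c < v" using dense by blast
    have "c \<notin> S" using c cSup_upper[of c S] S_le unfolding l_def by (auto simp: bdd_above_def)
    then have "\<forall>\<^sub>F t in at_top. w t \<le> c" using one_sided[OF c(1)] by (auto simp: S_def)
    then show "\<forall>\<^sub>F t in at_top. w t < v" by eventually_elim (use c in auto)
  qed
  have "l \<in> E"
  proof (rule ccontr)
    assume "l \<notin> E"
    then obtain \<sigma> r \<epsilon> where *: "\<sigma> \<in> {-1, 1}" "r > 0" "\<epsilon> > 0"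
      "\<forall>\<^sub>F t in at_top. \<bar>w t - l\<bar> < \<epsilon> \<longrightarrow> \<sigma> * R t \<ge> r" using push[OF \<open>l \<notin> E\<close>] by blast
    have "\<forall>\<^sub>F t in at_top. \<bar>w t - l\<bar> < \<epsilon>" using tendstoD[OF lim *(3)] by (simp add: dist_real_def)
    with *(4) der P p have "\<forall>\<^sub>F t in at_top. \<exists>d. ((\<lambda>t. \<sigma> * w t - r * P t) has_real_derivative d) (at t) \<and> d \<ge> 0"
    proof eventually_elim
      case (elim t)
      have "((\<lambda>t. \<sigma> * w t - r * P t) has_real_derivative \<sigma> * (p t * R t) - r * p t) (at t)"
        using elim by (auto intro!: derivative_eq_intros)
      moreover have "p t * (\<sigma> * R t - r) \<ge> 0" using elim by auto
      ultimately show ?case by (auto simp: algebra_simps)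
    qed
    then obtain T where T: "\<And>t. t \<ge> T \<Longrightarrow> \<exists>d. ((\<lambda>t. \<sigma> * w t - r * P t) has_real_derivative d) (at t) \<and> d \<ge> 0"
      by (auto simp: eventually_at_top_linorder)
    have mono: "\<sigma> * w T - r * P T \<le> \<sigma> * w t - r * P t" if "t \<ge> T" for t
      by (rule DERIV_nonneg_imp_nondecreasing[OF that]) (rule T)
    have "filterlim (\<lambda>t. (\<sigma> * w T - r * P T) + r * P t) at_top at_top"
      using P_top *(2)
      by (intro filterlim_tendsto_add_at_top[OF tendsto_const] filterlim_tendsto_pos_mult_at_top[OF tendsto_const])
    moreover have "\<forall>\<^sub>F t in at_top. (\<sigma> * w T - r * P T) + r * P t \<le> \<sigma> * w t"
      using eventually_ge_at_top[of T] by eventually_elim (use mono in force)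
    ultimately have "filterlim (\<lambda>t. \<sigma> * w t) at_top at_top" by (rule filterlim_at_top_mono)
    moreover have "((\<lambda>t. \<sigma> * w t) \<longlongrightarrow> \<sigma> * l) at_top" by (intro tendsto_intros lim)
    ultimately show False
      using not_tendsto_and_filterlim_at_infinity filterlim_at_top_imp_at_infinity trivial_limit_at_top_linorder by metis
  qed
  with lim show ?thesis by blast
qed

section \<open>The two-sided limit of the quotient\<close>

text \<open>
  The odd extension of the power function; it is the limit of \<open>f(yu)/f(y)\<close> on the whole line.
\<close>

definition signed_power :: "real \<Rightarrow> real \<Rightarrow> real" where
  "signed_power \<beta> v = sgn v * \<bar>v\<bar> powr \<beta>"

text \<open>
  The odd comparison function cancels: \<open>f(-y)/f(y)\<close> is \<open>-1\<close> times the quotient of \<open>f(-y)/\<phi>(-y)\<close>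
  and \<open>f(y)/\<phi>(y)\<close>.
\<close>

lemma asymptotically_odd:
  fixes f \<phi> :: "real \<Rightarrow> real"
  assumes odd: "\<And>y. \<phi> (- y) = - \<phi> y" and lim: "((\<lambda>y. f y / \<phi> y) \<longlongrightarrow> 1) (at 0)"
  shows "((\<lambda>y. f (- y) / f y) \<longlongrightarrow> - 1) (at 0)"
proof -
  have minus: "filterlim uminus (at 0) (at (0::real))"
    by (rule filterlim_atI) (auto intro!: tendsto_eq_intros simp: eventually_at_filter)
  have "((\<lambda>y. f (- y) / \<phi> (- y)) \<longlongrightarrow> 1) (at 0)"
    by (rule filterlim_compose[OF lim minus])
  then have "((\<lambda>y. - (f (- y) / \<phi> (- y)) / (f y / \<phi> y)) \<longlongrightarrow> - 1 / 1) (at 0)"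
    by (intro tendsto_divide tendsto_minus lim) auto
  moreover have "\<forall>\<^sub>F y in at 0. f y / \<phi> y > 0"
    using order_tendstoD(1)[OF lim, of 0] by simp
  then have "\<forall>\<^sub>F y in at 0. - (f (- y) / \<phi> (- y)) / (f y / \<phi> y) = f (- y) / f y"
    by eventually_elim (auto simp: odd)
  ultimately show ?thesis by (auto elim: Lim_transform_eventually)
qed

lemma odd_comparison:
  fixes f :: "real \<Rightarrow> real"
  assumes odd: "((\<lambda>y. f (- y) / f y) \<longlongrightarrow> - 1) (at 0)" and pos: "\<And>y. y > 0 \<Longrightarrow> f y > 0"
  shows "\<exists>d>0. \<forall>y. 0 < y \<and> y < d \<longrightarrow> f y / 2 \<le> - f (- y) \<and> - f (- y) \<le> 2 * f y"
proof -
  have "\<forall>\<^sub>F y in at 0. f (- y) / f y < - 1/2" "\<forall>\<^sub>F y in at 0. f (- y) / f y > - 2"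
    using order_tendstoD[OF odd] by auto
  then have "\<forall>\<^sub>F y in at 0. f (- y) / f y < - 1/2 \<and> f (- y) / f y > - 2"
    by eventually_elim simp
  then obtain d where d: "d > 0"
    "\<And>y. y \<noteq> 0 \<Longrightarrow> dist y 0 < d \<Longrightarrow> f (- y) / f y < - 1/2 \<and> f (- y) / f y > - 2"
    by (auto simp: eventually_at)
  have "f y / 2 \<le> - f (- y) \<and> - f (- y) \<le> 2 * f y" if "0 < y" "y < d" for y
    using d(2)[of y] that pos[of y] by (simp add: field_simps)
  then show ?thesis using d(1) by blast
qed

text \<open>
  Joint convergence in \<open>(y, u)\<close>, rather than convergence for fixed \<open>u\<close>, is what allows \<open>u\<close> to be
  replaced by a convergent function of time. The Potter bound with a small \<open>\<delta>\<close> supplies it.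
\<close>

lemma RV_quotient_tendsto_pos:
  assumes RV: "regularly_varying_at_0 f \<beta>" and cont: "continuous_on {0<..} f" and v: "v > 0"
  shows "((\<lambda>(y, u). f (y * u) / f y) \<longlongrightarrow> v powr \<beta>) (at_right 0 \<times>\<^sub>F nhds v)"
proof -
  let ?F = "at_right 0 \<times>\<^sub>F nhds v :: (real \<times> real) filter"
  have pos: "f x > 0" if "x > 0" for x using RV that by (auto simp: regularly_varying_at_0_def)
  have snd: "(snd \<longlongrightarrow> v) ?F" by (rule filterlim_snd)
  have u_pos: "\<forall>\<^sub>F p in ?F. snd p > 0" using order_tendstoD(1)[OF snd] v by blast
  have y_pos: "\<forall>\<^sub>F p in ?F. fst p > 0"
    using filterlim_fst[of "at_right (0::real)" "nhds v"] eventually_at_right_less[of "0::real"]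
    unfolding filterlim_iff by blast
  have ln_snd: "((\<lambda>p. ln (snd p)) \<longlongrightarrow> ln v) ?F" using snd v by (intro tendsto_ln) auto
  have "((\<lambda>p. ln (f (fst p * snd p) / f (fst p)) - \<beta> * ln (snd p)) \<longlongrightarrow> 0) ?F"
  proof (rule tendstoI)
    fix \<epsilon> :: real assume \<epsilon>: "\<epsilon> > 0"
    define \<delta> where "\<delta> = \<epsilon> / (3 + \<bar>ln v\<bar>)"
    have \<delta>: "\<delta> > 0" using \<epsilon> by (simp add: \<delta>_def add_pos_nonneg)
    obtain x0 where x0: "x0 > 0" "\<And>a b. a \<in> {0<..x0} \<Longrightarrow> b \<in> {0<..x0} \<Longrightarrow>
        \<bar>ln (f b / f a) - \<beta> * ln (b / a)\<bar> \<le> \<delta> * (1 + \<bar>ln (b / a)\<bar>)"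
      using Potter_bound[OF RV cont \<delta>] by blast
    have fst: "(fst \<longlongrightarrow> 0) ?F"
      using filterlim_fst[of "at_right (0::real)" "nhds v"] by (simp add: filterlim_at)
    have "((\<lambda>p. fst p * snd p) \<longlongrightarrow> 0) ?F" using tendsto_mult[OF fst snd] by simp
    then have "\<forall>\<^sub>F p in ?F. fst p * snd p < x0" using order_tendstoD(2) x0(1) by blast
    moreover have "\<forall>\<^sub>F p in ?F. fst p < x0" using order_tendstoD(2)[OF fst x0(1)] .
    moreover have "\<forall>\<^sub>F p in ?F. dist (ln (snd p)) (ln v) < 1" using tendstoD[OF ln_snd] by simp
    ultimately show "\<forall>\<^sub>F p in ?F. dist (ln (f (fst p * snd p) / f (fst p)) - \<beta> * ln (snd p)) 0 < \<epsilon>"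
      using u_pos y_pos
    proof eventually_elim
      case (elim p)
      then have "\<bar>ln (f (fst p * snd p) / f (fst p)) - \<beta> * ln (snd p)\<bar> \<le> \<delta> * (1 + \<bar>ln (snd p)\<bar>)"
        using x0(2)[of "fst p" "fst p * snd p"] by simp
      also have "\<dots> < \<delta> * (3 + \<bar>ln v\<bar>)"
        using elim \<delta> by (intro mult_strict_left_mono) (auto simp: dist_real_def)
      also have "\<dots> = \<epsilon>" by (simp add: \<delta>_def)
      finally show ?case by simp
    qed
  qed
  from tendsto_exp[OF tendsto_add[OF this tendsto_mult[OF tendsto_const[of \<beta>] ln_snd]]]
  have "((\<lambda>p. exp (ln (f (fst p * snd p) / f (fst p)))) \<longlongrightarrow> v powr \<beta>) ?F"
    using v by (simp add: powr_def)
  moreover have "\<forall>\<^sub>F p in ?F. exp (ln (f (fst p * snd p) / f (fst p))) = f (fst p * snd p) / f (fst p)"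
    using u_pos y_pos by eventually_elim (use pos in simp)
  ultimately show ?thesis by (auto simp: case_prod_unfold elim: Lim_transform_eventually)
qed

text \<open>
  The Potter bound with \<open>\<delta> = \<beta> - 1\<close> costs exactly the part of the exponent above \<open>1\<close>.
\<close>

lemma RV_quotient_le_linear:
  assumes RV: "regularly_varying_at_0 f \<beta>" and cont: "continuous_on {0<..} f" and \<beta>: "\<beta> > 1"
  shows "\<exists>C>0. \<exists>x0>0. \<forall>y\<in>{0<..x0}. \<forall>u\<in>{0<..1}. f (y * u) \<le> C * u * f y"
proof -
  have pos: "f x > 0" if "x > 0" for x using RV that by (auto simp: regularly_varying_at_0_def)
  obtain x0 where x0: "x0 > 0" "\<And>a b. a \<in> {0<..x0} \<Longrightarrow> b \<in> {0<..x0} \<Longrightarrow>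
      \<bar>ln (f b / f a) - \<beta> * ln (b / a)\<bar> \<le> (\<beta> - 1) * (1 + \<bar>ln (b / a)\<bar>)"
    using Potter_bound[OF RV cont, of "\<beta> - 1"] \<beta> by auto
  have "f (y * u) \<le> exp (\<beta> - 1) * u * f y" if "y \<in> {0<..x0}" "u \<in> {0<..1}" for y u
  proof -
    have yu: "y * u \<in> {0<..x0}"
    proof -
      have "y * u \<le> y" using that by (simp add: mult_left_le)
      then have "y * u \<le> x0" by (rule order_trans) (use that in simp)
      then show ?thesis using that by simp
    qed
    then have "\<bar>ln (f (y * u) / f y) - \<beta> * ln u\<bar> \<le> (\<beta> - 1) * (1 + \<bar>ln u\<bar>)"
      using x0(2)[OF that(1) yu] that by simp
    moreover have "ln u \<le> 0" using that by simp
    ultimately have "ln (f (y * u) / f y) \<le> (\<beta> - 1) + ln u" by (simp add: algebra_simps abs_le_iff)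
    moreover have "f (y * u) / f y > 0" using pos yu that by simp
    ultimately have "f (y * u) / f y \<le> exp ((\<beta> - 1) + ln u)" by (metis exp_le_cancel_iff exp_ln)
    also have "\<dots> = exp (\<beta> - 1) * u" using that by (simp only: exp_add) simp
    finally show ?thesis using that pos[of y] by (simp add: field_simps)
  qed
  then show ?thesis using x0(1) by (intro exI[of _ "exp (\<beta> - 1)"] conjI exI[of _ x0]) auto
qed

text \<open>
  For large \<open>u\<close> the Potter bound with \<open>\<delta> = (\<beta> - 1)/2\<close> gives growth of order
  \<open>u powr (1 + \<delta>)\<close>, which beats any linear function; \<open>M\<close> is chosen so that the surplus
  \<open>u powr \<delta>\<close> absorbs the Potter constant \<open>exp \<delta>\<close> together with \<open>C\<close>.
\<close>

lemma RV_quotient_superlinear: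
  assumes RV: "regularly_varying_at_0 f \<beta>" and cont: "continuous_on {0<..} f" and \<beta>: "\<beta> > 1"
  shows "\<exists>M. \<exists>x0>0. \<forall>y u. 0 < y \<longrightarrow> M \<le> u \<longrightarrow> y * u \<le> x0 \<longrightarrow> C * u * f y \<le> f (y * u)"
proof -
  have pos: "f x > 0" if "x > 0" for x using RV that by (auto simp: regularly_varying_at_0_def)
  define \<delta> where "\<delta> = (\<beta> - 1) / 2"
  have \<delta>: "\<delta> > 0" using \<beta> by (simp add: \<delta>_def)
  (* C may be negative or small; replacing it by C' \<ge> 1 makes its logarithm nonnegative. *)
  define C' where "C' = max 1 C"
  obtain x0 where x0: "x0 > 0" "\<And>a b. a \<in> {0<..x0} \<Longrightarrow> b \<in> {0<..x0} \<Longrightarrow>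
      \<bar>ln (f b / f a) - \<beta> * ln (b / a)\<bar> \<le> \<delta> * (1 + \<bar>ln (b / a)\<bar>)"
    using Potter_bound[OF RV cont \<delta>] by auto
  define M where "M = exp (1 + ln C' / \<delta>)"
  have "C * u * f y \<le> f (y * u)" if y: "0 < y" and u: "M \<le> u" and yu: "y * u \<le> x0" for y u
  proof -
    have "ln C' \<ge> 0" by (simp add: C'_def)
    then have "1 \<le> M" using \<delta> by (simp add: M_def)
    then have u1: "1 \<le> u" using u by simp
    have "y \<le> y * u" using y u1 by simp
    then have "y \<le> x0" using yu by simp
    then have *: "\<bar>ln (f (y * u) / f y) - \<beta> * ln u\<bar> \<le> \<delta> * (1 + \<bar>ln u\<bar>)"
      using x0(2)[of y "y * u"] y yu u1 by simp
    have "1 + ln C' / \<delta> \<le> ln u"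
      using u u1 unfolding M_def by (metis exp_gt_zero ln_exp ln_le_cancel_iff order_less_le_trans)
    then have "\<delta> * ln u \<ge> \<delta> * (1 + ln C' / \<delta>)" using \<delta> by simp
    then have "\<delta> * ln u \<ge> \<delta> + ln C'" using \<delta> by (simp add: algebra_simps)
    moreover have "\<beta> * ln u = ln u + 2 * \<delta> * ln u" by (simp add: \<delta>_def field_simps)
    moreover have "ln u \<ge> 0" using u1 by simp
    ultimately have "ln C' + ln u \<le> ln (f (y * u) / f y)"
      using * by (simp add: algebra_simps abs_le_iff)
    moreover have "f (y * u) / f y > 0" using pos y u1 by simp
    ultimately have "exp (ln C' + ln u) \<le> f (y * u) / f y" by (metis exp_le_cancel_iff exp_ln)
    then have "C' * u * f y \<le> f (y * u)"
      using u1 pos[OF y] by (simp add: exp_add field_simps C'_def)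
    moreover have "C * u * f y \<le> C' * u * f y"
      using u1 pos[OF y] by (intro mult_right_mono) (auto simp: C'_def)
    ultimately show ?thesis by simp
  qed
  then show ?thesis using x0(1) by blast
qed

text \<open>
  For \<open>v > 0\<close> this is the Potter bound, for \<open>v < 0\<close> asymptotic oddness reduces it to that case, and
  at \<open>v = 0\<close> the linear upper bound, carried to both signs of \<open>u\<close> by oddness, squeezes the quotient.
\<close>

lemma RV_quotient_tendsto:
  assumes RV: "regularly_varying_at_0 f \<beta>" and cont: "continuous_on {0<..} f" and \<beta>: "\<beta> > 1"
    and f0: "f 0 = 0" and odd: "((\<lambda>y. f (- y) / f y) \<longlongrightarrow> - 1) (at 0)"
  shows "((\<lambda>(y, u). f (y * u) / f y) \<longlongrightarrow> signed_power \<beta> v) (at_right 0 \<times>\<^sub>F nhds v)"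
proof -
  have pos: "f x > 0" if "x > 0" for x using RV that by (auto simp: regularly_varying_at_0_def)
  consider "v > 0" | "v = 0" | "v < 0" by linarith
  then show ?thesis
  proof cases
    case 1
    then show ?thesis using RV_quotient_tendsto_pos[OF RV cont] by (simp add: signed_power_def)
  next
    case 2
    obtain C x0 where C: "C > 0" "x0 > 0" "\<And>y u. y \<in> {0<..x0} \<Longrightarrow> u \<in> {0<..1} \<Longrightarrow> f (y * u) \<le> C * u * f y"
      using RV_quotient_le_linear[OF RV cont \<beta>] by blast
    obtain d where d: "d > 0" "\<And>y. 0 < y \<Longrightarrow> y < d \<Longrightarrow> - f (- y) \<le> 2 * f y \<and> f y / 2 \<le> - f (- y)"
      using odd_comparison[OF odd pos] by blast
    define e where "e = min x0 (d / 2)"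
    have e: "e > 0" "e \<le> x0" "e < d" using C(2) d(1) by (auto simp: e_def)
    have *: "\<bar>f (y * u) / f y\<bar> \<le> 2 * C * \<bar>u\<bar>" if y: "0 < y" "y < e" and u: "\<bar>u\<bar> < 1" for y u
    proof -
      consider "u = 0" | "u > 0" | "u < 0" by linarith
      then have "\<bar>f (y * u)\<bar> \<le> 2 * C * \<bar>u\<bar> * f y"
      proof cases
        case 1
        then show ?thesis by (simp add: f0)
      next
        case 2
        then have "\<bar>f (y * u)\<bar> = f (y * u)" "f (y * u) \<le> C * u * f y" "C * u * f y > 0"
          using pos[of "y * u"] pos[of y] y u e C by auto
        then show ?thesis using 2 by simp
      next
        case 3
        let ?z = "y * (- u)"
        have z: "0 < ?z" "?z < d"
          using 3 y u e mult_left_le[of "- u" y] by (auto simp: mult_pos_neg)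
        have "\<bar>f (y * u)\<bar> = - f (- ?z)"
          using d(2)[OF z] pos[OF z(1)] by simp
        also have "\<dots> \<le> 2 * f ?z" using d(2)[OF z] by simp
        also have "\<dots> \<le> 2 * (C * (- u) * f y)" using C(3)[of y "- u"] y u e 3 by simp
        finally show ?thesis using 3 by simp
      qed
      then show ?thesis using pos[OF y(1)] by (simp add: field_simps)
    qed
    have ev_y: "\<forall>\<^sub>F y in at_right 0. 0 < y \<and> y < e"
      using e(1) by (auto simp: eventually_at_right_field)
    have ev_u: "\<forall>\<^sub>F u in nhds (0::real). \<bar>u\<bar> < 1"
      using eventually_nhds_metric[of "\<lambda>u. \<bar>u\<bar> < 1" "0::real"] by (auto intro!: exI[of _ 1])
    have "\<forall>\<^sub>F p in at_right 0 \<times>\<^sub>F nhds 0. norm (f (fst p * snd p) / f (fst p)) \<le> 2 * C * \<bar>snd p\<bar>"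
      using eventually_prodI[OF ev_y ev_u] by eventually_elim (use * in auto)
    moreover have "((\<lambda>p. 2 * C * \<bar>snd p\<bar>) \<longlongrightarrow> 2 * C * \<bar>0\<bar>) (at_right (0::real) \<times>\<^sub>F nhds (0::real))"
      by (intro tendsto_intros filterlim_snd)
    then have "((\<lambda>p. 2 * C * \<bar>snd p\<bar>) \<longlongrightarrow> 0) (at_right (0::real) \<times>\<^sub>F nhds (0::real))"
      by simp
    ultimately have "((\<lambda>p. f (fst p * snd p) / f (fst p)) \<longlongrightarrow> 0) (at_right 0 \<times>\<^sub>F nhds 0)"
      by (rule Lim_null_comparison)
    then show ?thesis using 2 by (simp add: signed_power_def case_prod_unfold)
  next
    case 3
    let ?F = "at_right 0 \<times>\<^sub>F nhds v :: (real \<times> real) filter"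
    have neg: "filterlim (\<lambda>p. (fst p, - snd p)) (at_right 0 \<times>\<^sub>F nhds (- v)) ?F"
      by (rule filterlim_Pair[OF filterlim_fst tendsto_minus[OF filterlim_snd]])
    have "((\<lambda>p. f (fst p * - snd p) / f (fst p)) \<longlongrightarrow> (- v) powr \<beta>) ?F"
      using filterlim_compose[OF RV_quotient_tendsto_pos[OF RV cont, of "- v"] neg] 3 by simp
    moreover have snd_neg: "\<forall>\<^sub>F p in ?F. snd p < 0"
      using order_tendstoD(2)[OF filterlim_snd, of v 0] 3 by simp
    moreover have fst_pos: "\<forall>\<^sub>F p in ?F. fst p > 0"
      using filterlim_fst[of "at_right (0::real)" "nhds v"] eventually_at_right_less[of "0::real"]
      unfolding filterlim_iff by blast
    moreover have "((\<lambda>p. f (- (fst p * - snd p)) / f (fst p * - snd p)) \<longlongrightarrow> - 1) ?F"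
    proof (rule filterlim_compose[OF odd], rule filterlim_atI)
      have "(fst \<longlongrightarrow> 0) ?F"
        using filterlim_fst[of "at_right (0::real)" "nhds v"] by (simp add: filterlim_at)
      then have "((\<lambda>p. fst p * - snd p) \<longlongrightarrow> 0 * - v) ?F"
        by (intro tendsto_intros filterlim_snd)
      then show "((\<lambda>p. fst p * - snd p) \<longlongrightarrow> 0) ?F" by simp
      show "\<forall>\<^sub>F p in ?F. fst p * - snd p \<noteq> 0"
        using snd_neg fst_pos by eventually_elim auto
    qed
    ultimately have "((\<lambda>p. (f (- (fst p * - snd p)) / f (fst p * - snd p)) *
        (f (fst p * - snd p) / f (fst p))) \<longlongrightarrow> - 1 * (- v) powr \<beta>) ?F"
      by (intro tendsto_mult)
    moreover have "\<forall>\<^sub>F p in ?F. (f (- (fst p * - snd p)) / f (fst p * - snd p)) *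
        (f (fst p * - snd p) / f (fst p)) = f (fst p * snd p) / f (fst p)"
      using snd_neg fst_pos
    proof eventually_elim
      case (elim p)
      then have "f (fst p * - snd p) > 0" by (intro pos) (simp add: mult_pos_neg)
      then show ?case by simp
    qed
    ultimately have "((\<lambda>p. f (fst p * snd p) / f (fst p)) \<longlongrightarrow> - 1 * (- v) powr \<beta>) ?F"
      by (rule Lim_transform_eventually)
    then show ?thesis using 3 by (simp add: signed_power_def case_prod_unfold)
  qed
qed

text \<open>
  This makes the restoring force dominate when a solution is large compared with \<open>y\<close>: the joint
  limit is silent about unbounded \<open>v\<close>.
\<close>

lemma RV_quotient_growth:
  assumes RV: "regularly_varying_at_0 f \<beta>" and cont: "continuous_on {0<..} f" and \<beta>: "\<beta> > 1"
    and odd: "((\<lambda>y. f (- y) / f y) \<longlongrightarrow> - 1) (at 0)"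
  shows "\<exists>M>0. \<exists>x0>0. \<forall>y v. 0 < y \<longrightarrow> M \<le> \<bar>v\<bar> \<longrightarrow> \<bar>y * v\<bar> \<le> x0 \<longrightarrow>
           2 * \<bar>v\<bar> \<le> sgn v * (f (y * v) / f y)"
proof -
  have pos: "f x > 0" if "x > 0" for x using RV that by (auto simp: regularly_varying_at_0_def)
  obtain M x0 where M: "x0 > 0" "\<And>y u. 0 < y \<Longrightarrow> M \<le> u \<Longrightarrow> y * u \<le> x0 \<Longrightarrow> 4 * u * f y \<le> f (y * u)"
    using RV_quotient_superlinear[OF RV cont \<beta>] by blast
  obtain d where d: "d > 0" "\<And>y. 0 < y \<Longrightarrow> y < d \<Longrightarrow> f y / 2 \<le> - f (- y)"
    using odd_comparison[OF odd pos] by blast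
  have "2 * \<bar>v\<bar> \<le> sgn v * (f (y * v) / f y)"
    if y: "0 < y" and v: "max M 1 \<le> \<bar>v\<bar>" and yv: "\<bar>y * v\<bar> \<le> min x0 (d / 2)" for y v
  proof -
    have *: "4 * \<bar>v\<bar> * f y \<le> f (y * \<bar>v\<bar>)"
      using M(2)[of y "\<bar>v\<bar>"] y v yv by (simp add: abs_mult)
    have z: "0 < y * \<bar>v\<bar>" "y * \<bar>v\<bar> < d" using y v yv d(1) by (auto simp: abs_mult)
    show ?thesis
    proof (cases "v > 0")
      case True
      then have "2 * v * f y \<le> 4 * \<bar>v\<bar> * f y" using pos[OF y] by simp
      also have "\<dots> \<le> f (y * v)" using * True by simp
      finally have "2 * v * f y \<le> f (y * v)" .
      then show ?thesis using True pos[OF y] by (simp add: pos_le_divide_eq)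
    next
      case False
      then have "v < 0" using v by auto
      then show ?thesis using * d(2)[OF z] pos[OF y] by (simp add: field_simps)
    qed
  qed
  then show ?thesis using M(1) d(1)
    by (intro exI[of _ "max M 1"] conjI exI[of _ "min x0 (d / 2)"]) auto
qed

section \<open>Tail asymptotics\<close>

text \<open>
  L'Hospital's rule of type \<open>0/0\<close> at infinity, where the convergence of \<open>H\<close> is part of the
  conclusion. For \<open>K = H + c y\<close> the derivative is small compared with that of \<open>y\<close>, so increments of
  \<open>K\<close> are at most \<open>\<epsilon>\<close> times the corresponding decrease of \<open>y\<close>; this makes \<open>K\<close> convergent and bounds
  its distance to the limit by \<open>\<epsilon> y\<close>.
\<close>

lemma LHospital_at_top_0_over_0:
  fixes H h y y' :: "real \<Rightarrow> real"
  assumes H: "\<forall>\<^sub>F t in at_top. (H has_real_derivative h t) (at t)"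
    and y: "\<forall>\<^sub>F t in at_top. (y has_real_derivative - y' t) (at t)"
    and pos: "\<forall>\<^sub>F t in at_top. y t > 0" "\<forall>\<^sub>F t in at_top. y' t > 0"
    and y0: "(y \<longlongrightarrow> 0) at_top"
    and quot: "((\<lambda>t. h t / y' t) \<longlongrightarrow> c) at_top"
  shows "\<exists>L. (H \<longlongrightarrow> L) at_top \<and> ((\<lambda>t. (L - H t) / y t) \<longlongrightarrow> c) at_top"
proof -
  define K where "K t = H t + c * y t" for t
  have key: "\<exists>T. (\<forall>t\<ge>T. y t > 0) \<and> (\<forall>t\<ge>T. \<forall>s\<ge>t. \<bar>K s - K t\<bar> \<le> \<epsilon> * (y t - y s))" if \<epsilon>: "\<epsilon> > 0" for \<epsilon>
  proof -
    have "\<forall>\<^sub>F t in at_top. dist (h t / y' t) c < \<epsilon>" using tendstoD[OF quot \<epsilon>] .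
    with H y pos have "\<forall>\<^sub>F t in at_top. y t > 0 \<and>
        (\<exists>k. (K has_real_derivative k) (at t) \<and> \<bar>k\<bar> \<le> \<epsilon> * y' t) \<and> (y has_real_derivative - y' t) (at t)"
    proof eventually_elim
      case (elim t)
      have "(K has_real_derivative h t - c * y' t) (at t)"
        unfolding K_def using elim by (auto intro!: derivative_eq_intros)
      moreover have "\<bar>h t - c * y' t\<bar> \<le> \<epsilon> * y' t"
        using elim by (simp add: dist_real_def field_simps abs_le_iff abs_less_iff)
      ultimately show ?case using elim by blast
    qed
    then obtain T k where T: "\<And>t. t \<ge> T \<Longrightarrow> y t > 0" "\<And>t. t \<ge> T \<Longrightarrow> (K has_real_derivative k t) (at t)"
      "\<And>t. t \<ge> T \<Longrightarrow> \<bar>k t\<bar> \<le> \<epsilon> * y' t" "\<And>t. t \<ge> T \<Longrightarrow> (y has_real_derivative - y' t) (at t)"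
      unfolding eventually_at_top_linorder by metis
    have "\<bar>K s - K t\<bar> \<le> \<epsilon> * (y t - y s)" if "t \<ge> T" "s \<ge> t" for t s
    proof -
      have "K s + \<epsilon> * y s \<le> K t + \<epsilon> * y t"
      proof (rule DERIV_nonpos_imp_nonincreasing[OF that(2)])
        fix r assume "t \<le> r"
        then have "((\<lambda>t. K t + \<epsilon> * y t) has_real_derivative k r - \<epsilon> * y' r) (at r)" "k r - \<epsilon> * y' r \<le> 0"
          using T[of r] that by (auto intro!: derivative_eq_intros)
        then show "\<exists>d. ((\<lambda>t. K t + \<epsilon> * y t) has_real_derivative d) (at r) \<and> d \<le> 0" by blast
      qed
      moreover have "K t - \<epsilon> * y t \<le> K s - \<epsilon> * y s"
      proof (rule DERIV_nonneg_imp_nondecreasing[OF that(2)])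
        fix r assume "t \<le> r"
        then have "((\<lambda>t. K t - \<epsilon> * y t) has_real_derivative k r + \<epsilon> * y' r) (at r)" "k r + \<epsilon> * y' r \<ge> 0"
          using T[of r] that by (auto intro!: derivative_eq_intros)
        then show "\<exists>d. ((\<lambda>t. K t - \<epsilon> * y t) has_real_derivative d) (at r) \<and> d \<ge> 0" by blast
      qed
      ultimately show ?thesis by (simp add: algebra_simps abs_le_iff)
    qed
    then show ?thesis using T(1) by blast
  qed
  have "\<exists>L. (K \<longlongrightarrow> L) at_top"
  proof -
    obtain T where T: "\<And>t. t \<ge> T \<Longrightarrow> y t > 0" "\<And>t s. t \<ge> T \<Longrightarrow> s \<ge> t \<Longrightarrow> \<bar>K s - K t\<bar> \<le> 1 * (y t - y s)"
      using key[OF zero_less_one] by blast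
    (* The key estimate with \<epsilon> = 1 makes K - y increasing and bounded above, and y tends to 0. *)
    define S where "S = (\<lambda>t. K t - y t) ` {T..}"
    have mono: "K t - y t \<le> K s - y s" if "T \<le> t" "t \<le> s" for t s using T(2)[OF that] by (simp add: abs_le_iff)
    have bdd: "bdd_above S"
    proof (rule bdd_aboveI[of _ "K T + y T"])
      fix z assume "z \<in> S"
      then obtain t where "t \<ge> T" "z = K t - y t" by (auto simp: S_def)
      then show "z \<le> K T + y T" using T(1)[of t] T(2)[of T t] by simp
    qed
    have "((\<lambda>t. K t - y t) \<longlongrightarrow> Sup S) at_top"
    proof (rule increasing_tendsto)
      show "\<forall>\<^sub>F t in at_top. K t - y t \<le> Sup S"
        using eventually_ge_at_top[of T] 
      proof eventually_elim
        case (elim t)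
        then show ?case by (intro cSup_upper bdd) (auto simp: S_def)
      qed
      fix v assume "v < Sup S"
      then obtain t where t: "t \<ge> T" "v < K t - y t"
        by (subst (asm) less_cSup_iff) (use bdd in \<open>auto simp: S_def\<close>)
      show "\<forall>\<^sub>F s in at_top. v < K s - y s"
        using eventually_ge_at_top[of t] by eventually_elim (use mono t in force)
    qed
    from tendsto_add[OF this y0] show ?thesis by auto
  qed
  then obtain L where L: "(K \<longlongrightarrow> L) at_top" ..
  from tendsto_diff[OF L tendsto_mult[OF tendsto_const[of c] y0]]
  have HL: "(H \<longlongrightarrow> L) at_top" by (simp add: K_def)
  have "((\<lambda>t. (L - H t) / y t) \<longlongrightarrow> c) at_top"
  proof (rule tendstoI)
    fix \<epsilon> :: real assume \<epsilon>: "\<epsilon> > 0"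
    obtain T where T: "\<And>t. t \<ge> T \<Longrightarrow> y t > 0" "\<And>t s. t \<ge> T \<Longrightarrow> s \<ge> t \<Longrightarrow> \<bar>K s - K t\<bar> \<le> \<epsilon> / 2 * (y t - y s)"
      using key[OF half_gt_zero[OF \<epsilon>]] by blast
    show "\<forall>\<^sub>F t in at_top. dist ((L - H t) / y t) c < \<epsilon>"
      using eventually_ge_at_top[of T]
    proof eventually_elim
      case (elim t)
      have yt: "y t > 0" using T(1) elim by simp
      have "((\<lambda>s. \<bar>K s - K t\<bar>) \<longlongrightarrow> \<bar>L - K t\<bar>) at_top" by (intro tendsto_intros L)
      moreover have "\<forall>\<^sub>F s in at_top. \<bar>K s - K t\<bar> \<le> \<epsilon> / 2 * y t"
        using eventually_ge_at_top[of t]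
      proof eventually_elim
        case (elim s)
        have "\<epsilon> / 2 * (y t - y s) \<le> \<epsilon> / 2 * y t"
          using T(1)[of s] \<open>T \<le> t\<close> elim \<epsilon> by (intro mult_left_mono) auto
        then show ?case using T(2)[OF \<open>T \<le> t\<close> elim] by linarith
      qed
      ultimately have "\<bar>L - K t\<bar> \<le> \<epsilon> / 2 * y t"
        by (rule tendsto_upperbound) simp
      also have "\<dots> < \<epsilon> * y t" using \<epsilon> yt by simp
      finally have "\<bar>(L - K t) / y t\<bar> < \<epsilon>" using yt by (simp add: field_simps)
      moreover have "(L - H t) / y t - c = (L - K t) / y t" using yt by (simp add: K_def field_simps)
      ultimately show ?case by (simp add: dist_real_def)
    qed
  qed
  with HL show ?thesis by blast
qed

section \<open>The unperturbed solution\<close>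

lemma LBINT_has_real_derivative:
  fixes g :: "real \<Rightarrow> real"
  assumes cont: "continuous_on S g" and "{a..b} \<subseteq> S" "a \<le> c" "c \<le> b" "a < x" "x < b"
  shows "((\<lambda>u. LBINT s=ereal c..ereal u. g s) has_real_derivative g x) (at x)"
proof -
  have "((\<lambda>u. LBINT s=ereal c..ereal u. g s) has_vector_derivative g x) (at x within {a..b})"
    using assms by (intro interval_integral_FTC2) (auto intro: continuous_on_subset)
  moreover have "at x within {a..b} = at x" using assms by (intro at_within_Icc_at) auto
  ultimately show ?thesis by (simp add: has_real_derivative_iff_has_vector_derivative)
qed

lemma F_has_real_derivative:
  assumes cont: "continuous_on {0<..} f" and pos: "\<And>y. y > 0 \<Longrightarrow> f y > 0" and x: "x > 0"
  shows "(F f has_real_derivative - (1 / f x)) (at x)"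
proof -
  have "continuous_on {0<..} (\<lambda>u. 1 / f u)"
    using pos by (intro continuous_intros cont) force
  then have "((\<lambda>u. LBINT s=ereal 1..ereal u. 1 / f s) has_real_derivative 1 / f x) (at x)"
    by (rule LBINT_has_real_derivative[where a = "min 1 (x / 2)" and b = "max 1 (x + 1)"]) (use x in auto)
  from DERIV_minus[OF this] show ?thesis
    unfolding F_def by (subst interval_integral_endpoints_reverse) (simp add: one_ereal_def)
qed

lemma F_strict_antimono:
  assumes cont: "continuous_on {0<..} f" and pos: "\<And>y. y > 0 \<Longrightarrow> f y > 0" and "0 < x" "x < y"
  shows "F f y < F f x"
  using assms(4)
proof (rule DERIV_neg_imp_decreasing)
  fix z assume "x \<le> z" "z \<le> y"
  then show "\<exists>d. (F f has_real_derivative d) (at z) \<and> d < 0"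
    using F_has_real_derivative[OF cont pos, of z] pos[of z] assms(3) by (intro exI conjI) auto
qed

text \<open>
  Near \<open>0\<close> one has \<open>f(u) \<le> u\<close>, so \<open>F\<close> grows at least as fast as \<open>- ln\<close>.
\<close>

lemma F_at_top:
  assumes cont: "continuous_on {0<..} f" and pos: "\<And>y. y > 0 \<Longrightarrow> f y > 0"
    and small: "((\<lambda>y. f y / y) \<longlongrightarrow> 0) (at_right 0)"
  shows "filterlim (F f) at_top (at_right 0)"
proof -
  have "\<forall>\<^sub>F y in at_right 0. f y / y < 1" using order_tendstoD(2)[OF small, of 1] by simp
  then obtain b where b: "b > 0" "\<And>y. 0 < y \<Longrightarrow> y < b \<Longrightarrow> f y / y < 1"
    by (auto simp: eventually_at_right_field)
  define c where "c = b / 2"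
  have c: "c > 0" "c < b" using b by (auto simp: c_def)
  have "F f c + ln c + - ln x \<le> F f x" if x: "0 < x" "x < c" for x
  proof -
    have "F f c + ln c \<le> F f x + ln x"
    proof (rule DERIV_nonpos_imp_nonincreasing[where f = "\<lambda>x. F f x + ln x"])
      show "x \<le> c" using x by simp
      fix y assume y: "x \<le> y" "y \<le> c"
      then have "f y < y" using b(2)[of y] x c by (simp add: field_simps)
      then have "- (1 / f y) + 1 / y \<le> 0" using pos[of y] y x by (simp add: field_simps)
      moreover have "((\<lambda>x. F f x + ln x) has_real_derivative - (1 / f y) + 1 / y) (at y)"
        using F_has_real_derivative[OF cont pos, of y] x y by (auto intro!: derivative_eq_intros)
      ultimately show "\<exists>d. ((\<lambda>x. F f x + ln x) has_real_derivative d) (at y) \<and> d \<le> 0" by blast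
    qed
    then show ?thesis by simp
  qed
  then have "\<forall>\<^sub>F x in at_right 0. F f c + ln c + - ln x \<le> F f x"
    using c by (auto simp: eventually_at_right_field)
  moreover have "filterlim (\<lambda>x. F f c + ln c + - ln x) at_top (at_right 0)"
    by (intro filterlim_tendsto_add_at_top[OF tendsto_const]
        filterlim_compose[OF filterlim_uminus_at_top_at_bot ln_at_0])
  ultimately show ?thesis by (rule filterlim_at_top_mono[rotated])
qed

text \<open>
  \<open>F_inv f\<close> is the solution of the unperturbed equation \<open>y' = - f y\<close> with \<open>y 0 = 1\<close>, the reference
  scale against which \<open>x\<close> is measured.
\<close>

lemma F_inv_solves_ode:
  assumes cont: "continuous_on {0<..} f" and pos: "\<And>y. y > 0 \<Longrightarrow> f y > 0"
    and small: "((\<lambda>y. f y / y) \<longlongrightarrow> 0) (at_right 0)"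
  shows "\<And>t. t \<ge> 0 \<Longrightarrow> F_inv f t > 0"
    and "\<And>t. t > 0 \<Longrightarrow> (F_inv f has_real_derivative - f (F_inv f t)) (at t)"
    and "(F_inv f \<longlongrightarrow> 0) at_top"
proof -
  have anti: "F f y < F f x" if "0 < x" "x < y" for x y using F_strict_antimono[OF cont pos that] .
  have inj: "inj_on (F f) {0<..}"
  proof (rule inj_onI)
    fix x y assume "x \<in> {0<..}" "y \<in> {0<..}" "F f x = F f y"
    then show "x = y" using anti[of x y] anti[of y x] by (cases x y rule: linorder_cases) auto
  qed
  have left_inv: "F_inv f (F f x) = x" if "x > 0" for x
    unfolding F_inv_def using the_inv_into_f_f[OF inj] that by simp
  have isCont_F: "isCont (F f) x" if "x > 0" for x
    using F_has_real_derivative[OF cont pos that] by (rule DERIV_isCont)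
  have F1: "F f 1 = 0" by (simp add: F_def one_ereal_def)
  have ex: "\<exists>x>0. F f x = t" if t: "t \<ge> 0" for t
  proof -
    have "\<forall>\<^sub>F x in at_right 0. F f x \<ge> t"
      using F_at_top[OF assms] by (simp add: filterlim_at_top)
    then have "\<forall>\<^sub>F x in at_right 0. F f x \<ge> t \<and> x > 0 \<and> x < 1"
      using eventually_at_right_less[of "0::real"] eventually_at_right_real[OF zero_less_one]
      by eventually_elim auto
    then obtain a where a: "F f a \<ge> t" "0 < a" "a < 1"
      using eventually_happens[of _ "at_right (0::real)"] by (auto simp: trivial_limit_at_right_real)
    have "\<exists>x. a \<le> x \<and> x \<le> 1 \<and> F f x = t"
      using a t F1 isCont_F by (intro IVT2) auto
    then obtain x where "a \<le> x" "F f x = t" by blast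
    with a(2) show ?thesis by (intro exI[of _ x]) auto
  qed
  show y_pos: "F_inv f t > 0" if "t \<ge> 0" for t using ex[OF that] left_inv by auto
  have right_inv: "F f (F_inv f t) = t" if "t \<ge> 0" for t using ex[OF that] left_inv by auto
  show "(F_inv f has_real_derivative - f (F_inv f t)) (at t)" if t: "t > 0" for t
  proof -
    let ?x = "F_inv f t"
    have x: "?x > 0" using y_pos t by simp
    have "isCont (F_inv f) (F f ?x)"
      by (rule isCont_inverse_function2[of "?x / 2" _ "2 * ?x"]) (use x left_inv isCont_F in auto)
    then have "isCont (F_inv f) t" using right_inv t by simp
    then have "(F_inv f has_real_derivative inverse (- (1 / f ?x))) (at t)"
      by (intro DERIV_inverse_function[of "F f" _ _ _ 0 "t + 1"])
        (use F_has_real_derivative[OF cont pos x] pos[OF x] t right_inv in auto)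
    then show ?thesis by simp
  qed
  show "(F_inv f \<longlongrightarrow> 0) at_top"
  proof (rule order_tendstoI)
    fix a :: real assume "a < 0"
    show "\<forall>\<^sub>F t in at_top. a < F_inv f t"
      using eventually_ge_at_top[of 0] by eventually_elim (use y_pos \<open>a < 0\<close> in force)
  next
    fix a :: real assume a: "0 < a"
    show "\<forall>\<^sub>F t in at_top. F_inv f t < a"
      using eventually_ge_at_top[of 0] eventually_gt_at_top[of "F f a"]
    proof eventually_elim
      case (elim t)
      show ?case
      proof (rule ccontr)
        assume "\<not> F_inv f t < a"
        then have "F f (F_inv f t) \<le> F f a" using anti[OF a, of "F_inv f t"] by force
        then show False using right_inv elim by simp
      qed
    qed
  qed
qed

section \<open>The perturbed equation\<close>

lemma signed_power_fixed_point_iff: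
  assumes "\<beta> > 1"
  shows "signed_power \<beta> v = v \<longleftrightarrow> v \<in> {-1, 0, 1}"
proof -
  have "\<bar>v\<bar> powr \<beta> = \<bar>v\<bar> \<longleftrightarrow> \<bar>v\<bar> = 1" if "v \<noteq> 0"
  proof
    assume "\<bar>v\<bar> powr \<beta> = \<bar>v\<bar>"
    then have "\<bar>v\<bar> powr (\<beta> - 1) = 1" using that by (simp add: powr_diff)
    then have "(\<beta> - 1) * ln \<bar>v\<bar> = 0" using that by (metis abs_eq_0 exp_eq_one_iff powr_def)
    then show "\<bar>v\<bar> = 1" using assms that by (simp add: ln_eq_zero_iff)
  qed simp
  moreover have "signed_power \<beta> v = v \<longleftrightarrow> \<bar>v\<bar> powr \<beta> = \<bar>v\<bar>" if "v \<noteq> 0"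
    using that by (cases "v > 0") (auto simp: signed_power_def)
  ultimately show ?thesis by (cases "v = 0") (auto simp: signed_power_def)
qed

text \<open>
  Adding the tail \<open>L - G\<close> of the forcing term to \<open>x\<close> removes \<open>g\<close> from the equation. The quotient
  \<open>w = (x + (L - G))/y\<close> then satisfies \<open>w' = (f(y)/y) (w - f(x)/f(y))\<close>, and \<open>x/y\<close> differs from \<open>w\<close>
  by a null function, so in the time scale \<open>- ln y\<close> this is a perturbation of the autonomous
  equation \<open>dw/ds = w - sgn w * |w| powr \<beta>\<close> with equilibria \<open>-1\<close>, \<open>0\<close>, \<open>1\<close>.
\<close>

lemma small_tail_imp_asymptotic_profile:
  fixes f x y g G :: "real \<Rightarrow> real"
  assumes \<beta>: "\<beta> > 1" and f_pos: "\<And>u. u > 0 \<Longrightarrow> f u > 0"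
    and quot: "\<And>v. ((\<lambda>(y, u). f (y * u) / f y) \<longlongrightarrow> signed_power \<beta> v) (at_right 0 \<times>\<^sub>F nhds v)"
    and growth: "\<exists>M>0. \<exists>x0>0. \<forall>y v. 0 < y \<longrightarrow> M \<le> \<bar>v\<bar> \<longrightarrow> \<bar>y * v\<bar> \<le> x0 \<longrightarrow>
           2 * \<bar>v\<bar> \<le> sgn v * (f (y * v) / f y)"
    and y_der: "\<forall>\<^sub>F t in at_top. (y has_real_derivative - f (y t)) (at t)"
    and y_pos: "\<forall>\<^sub>F t in at_top. y t > 0" and y_lim: "(y \<longlongrightarrow> 0) at_top"
    and x_der: "\<forall>\<^sub>F t in at_top. (x has_real_derivative - f (x t) + g t) (at t)"
    and G_der: "\<forall>\<^sub>F t in at_top. (G has_real_derivative g t) (at t)"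
    and x_lim: "(x \<longlongrightarrow> 0) at_top"
    and tail: "((\<lambda>t. (L - G t) / y t) \<longlongrightarrow> 0) at_top"
  shows "\<exists>l\<in>{-1, 0, 1}. ((\<lambda>t. x t / y t) \<longlongrightarrow> l) at_top"
proof -
  define w where "w t = (x t + (L - G t)) / y t" for t
  define p where "p t = f (y t) / y t" for t
  define R where "R t = w t - f (x t) / f (y t)" for t
  have y_right: "filterlim y (at_right 0) at_top"
    using y_lim y_pos by (auto simp: filterlim_at elim: eventually_mono)
  have w_diff: "((\<lambda>t. w t - x t / y t) \<longlongrightarrow> 0) at_top"
    using tail by (simp add: w_def add_divide_distrib)
  have near: "\<forall>\<^sub>F t in at_top. \<bar>w t - x t / y t\<bar> < d" if "d > 0" for d
    using tendstoD[OF w_diff that] by simp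
  obtain M x0 where M: "M > 0" "x0 > 0"
    "\<And>y v. 0 < y \<Longrightarrow> M \<le> \<bar>v\<bar> \<Longrightarrow> \<bar>y * v\<bar> \<le> x0 \<Longrightarrow> 2 * \<bar>v\<bar> \<le> sgn v * (f (y * v) / f y)"
    using growth by blast
  have "\<exists>l\<in>{-1, 0, 1}. (w \<longlongrightarrow> l) at_top"
  proof (rule asymptotically_autonomous_convergence)
    show "\<forall>\<^sub>F t in at_top. (w has_real_derivative p t * R t) (at t)"
      using x_der G_der y_der y_pos
    proof eventually_elim
      case (elim t)
      then have "(w has_real_derivative ((- f (x t)) * y t - (x t + (L - G t)) * (- f (y t))) / (y t * y t)) (at t)"
        unfolding w_def by (auto intro!: derivative_eq_intros)
      also have "((- f (x t)) * y t - (x t + (L - G t)) * (- f (y t))) / (y t * y t) = p t * R t"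
        using elim f_pos[of "y t"] by (simp add: p_def R_def w_def divide_simps)
      finally show ?case .
    qed
    show "\<forall>\<^sub>F t in at_top. p t > 0"
      using y_pos by eventually_elim (simp add: p_def f_pos)
    show "\<forall>\<^sub>F t in at_top. ((\<lambda>t. - ln (y t)) has_real_derivative p t) (at t)"
      using y_der y_pos by eventually_elim (auto intro!: derivative_eq_intros simp: p_def)
    show "filterlim (\<lambda>t. - ln (y t)) at_top at_top"
      by (rule filterlim_compose[OF filterlim_uminus_at_top_at_bot filterlim_compose[OF ln_at_0 y_right]])
    show "finite {-1, 0, 1 :: real}" by simp
  next
    fix v :: real assume v: "v \<notin> {-1, 0, 1}"
    (* D is the right-hand side of the autonomous limit equation at v. Up to errors of size
       |D|/4 from the quotient limit and from replacing w t by v, R t equals D near v. *)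
    define D where "D = v - signed_power \<beta> v"
    have D: "D \<noteq> 0" using signed_power_fixed_point_iff[OF \<beta>, of v] v by (auto simp: D_def)
    then have "\<bar>D\<bar> / 4 > 0" by simp
    from tendstoD[OF quot this, of v] obtain A B where
      A: "eventually A (at_right 0)" and B: "eventually B (nhds v)"
      and AB: "\<And>y u. A y \<Longrightarrow> B u \<Longrightarrow> \<bar>f (y * u) / f y - signed_power \<beta> v\<bar> < \<bar>D\<bar> / 4"
      unfolding eventually_prod_filter dist_real_def by fastforce
    obtain d where d: "d > 0" "\<And>u. \<bar>u - v\<bar> < d \<Longrightarrow> B u"
      using B unfolding eventually_nhds_metric dist_real_def by blast
    define \<epsilon> where "\<epsilon> = min (d / 2) (\<bar>D\<bar> / 4)"
    have \<epsilon>: "\<epsilon> > 0" using d D by (simp add: \<epsilon>_def)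
    have "\<forall>\<^sub>F t in at_top. A (y t)" using y_right A by (simp add: filterlim_iff)
    moreover have "\<forall>\<^sub>F t in at_top. \<bar>w t - x t / y t\<bar> < d / 2" by (rule near) (use d(1) in simp)
    ultimately have "\<forall>\<^sub>F t in at_top. \<bar>w t - v\<bar> < \<epsilon> \<longrightarrow> sgn D * R t \<ge> \<bar>D\<bar> / 2"
      using y_pos
    proof eventually_elim
      case (elim t)
      show ?case
      proof
        assume wv: "\<bar>w t - v\<bar> < \<epsilon>"
        then have "\<bar>w t - v\<bar> < d / 2" by (simp add: \<epsilon>_def)
        moreover have "\<bar>w t - x t / y t\<bar> < d / 2" using elim by blast
        ultimately have "\<bar>x t / y t - v\<bar> < d" by (smt (verit) field_sum_of_halves)
        then have "\<bar>f (y t * (x t / y t)) / f (y t) - signed_power \<beta> v\<bar> < \<bar>D\<bar> / 4"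
          using AB elim d(2) by blast
        then have "\<bar>f (x t) / f (y t) - signed_power \<beta> v\<bar> < \<bar>D\<bar> / 4" using elim by simp
        moreover have "\<bar>w t - v\<bar> < \<bar>D\<bar> / 4" using wv by (simp add: \<epsilon>_def)
        ultimately have RD: "\<bar>R t - D\<bar> < \<bar>D\<bar> / 2" unfolding R_def D_def by linarith
        show "sgn D * R t \<ge> \<bar>D\<bar> / 2"
          using D RD by (auto simp: abs_if sgn_if field_simps split: if_splits)
      qed
    qed
    moreover have "sgn D \<in> {-1, 1}" using D by (simp add: sgn_if)
    ultimately show "\<exists>\<sigma>\<in>{-1, 1}. \<exists>r>0. \<exists>\<epsilon>>0. \<forall>\<^sub>F t in at_top. \<bar>w t - v\<bar> < \<epsilon> \<longrightarrow> \<sigma> * R t \<ge> r"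
      using \<epsilon> D by (intro bexI[of _ "sgn D"] exI[of _ "\<bar>D\<bar> / 2"] exI[of _ \<epsilon>] conjI) auto
  next
    have "((\<lambda>t. \<bar>x t\<bar>) \<longlongrightarrow> 0) at_top" using x_lim by (rule tendsto_rabs_zero)
    then have "\<forall>\<^sub>F t in at_top. \<bar>x t\<bar> < x0" using M(2) by (rule order_tendstoD(2))
    moreover have "\<forall>\<^sub>F t in at_top. \<bar>w t - x t / y t\<bar> < 1" by (rule near) simp
    ultimately have *: "\<forall>\<^sub>F t in at_top. \<bar>w t - x t / y t\<bar> < 1 \<and>
        (max M 1 \<le> \<bar>x t / y t\<bar> \<longrightarrow> 2 * \<bar>x t / y t\<bar> \<le> sgn (x t / y t) * (f (x t) / f (y t)))"
      using y_pos
    proof eventually_elim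
      case (elim t)
      then show ?case using M(3)[of "y t" "x t / y t"] by (auto simp del: abs_divide)
    qed
    (* When |w t| \<ge> max M 1 + 1, the quotient u = x t / y t satisfies |u| \<ge> max M 1, and then
       2 * |u| \<ge> |u| + 1 \<ge> |w t|. *)
    show "\<forall>\<^sub>F t in at_top. w t \<ge> max M 1 + 1 \<longrightarrow> R t \<le> 0"
      using *
    proof eventually_elim
      case (elim t)
      show ?case
      proof
        assume "w t \<ge> max M 1 + 1"
        then have u: "x t / y t \<ge> max M 1" "x t / y t > 0" using elim by linarith+
        then have u_abs: "\<bar>x t / y t\<bar> = x t / y t" and u_sgn: "sgn (x t / y t) = 1"
          by (simp_all only: abs_of_pos sgn_pos)
        have "max M 1 \<le> \<bar>x t / y t\<bar>" using u u_abs by linarith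
        then have "2 * (x t / y t) \<le> 1 * (f (x t) / f (y t))"
          using elim unfolding u_abs u_sgn by blast
        then have "2 * (x t / y t) \<le> f (x t) / f (y t)" by linarith
        then show "R t \<le> 0" using u elim unfolding R_def by linarith
      qed
    qed
    show "\<forall>\<^sub>F t in at_top. w t \<le> - (max M 1 + 1) \<longrightarrow> R t \<ge> 0"
      using *
    proof eventually_elim
      case (elim t)
      show ?case
      proof
        assume "w t \<le> - (max M 1 + 1)"
        then have u: "x t / y t \<le> - max M 1" "x t / y t < 0" using elim by linarith+
        then have u_abs: "\<bar>x t / y t\<bar> = - (x t / y t)" and u_sgn: "sgn (x t / y t) = - 1"
          by (simp_all only: abs_of_neg sgn_neg)
        have "max M 1 \<le> \<bar>x t / y t\<bar>" using u u_abs by linarith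
        then have "2 * (- (x t / y t)) \<le> - 1 * (f (x t) / f (y t))"
          using elim unfolding u_abs u_sgn by blast
        then have "- 2 * (x t / y t) \<le> - (f (x t) / f (y t))" by linarith
        then show "R t \<ge> 0" using u elim unfolding R_def by linarith
      qed
    qed
  qed
  then obtain l where l: "l \<in> {-1, 0, 1}" "(w \<longlongrightarrow> l) at_top" by blast
  have "((\<lambda>t. x t / y t) \<longlongrightarrow> l) at_top" using tendsto_diff[OF l(2) w_diff] by simp
  with l(1) show ?thesis by blast
qed

text \<open>
  Put \<open>H = G - x\<close>, so that \<open>H' = f(x)\<close>. If \<open>x/y \<rightarrow> l\<close> then \<open>f(x)/f(y) \<rightarrow> l\<close> because \<open>l\<close> is fixed by the
  limit function, so by L'Hospital the tail of \<open>H\<close> is asymptotic to \<open>l y\<close>. It cancels against \<open>x\<close>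
  to leading order, and what remains is the tail of \<open>G\<close>.
\<close>

lemma asymptotic_profile_imp_small_tail:
  fixes f x y g G :: "real \<Rightarrow> real"
  assumes f_pos: "\<And>u. u > 0 \<Longrightarrow> f u > 0"
    and quot: "((\<lambda>(y, u). f (y * u) / f y) \<longlongrightarrow> l) (at_right 0 \<times>\<^sub>F nhds l)"
    and y_der: "\<forall>\<^sub>F t in at_top. (y has_real_derivative - f (y t)) (at t)"
    and y_pos: "\<forall>\<^sub>F t in at_top. y t > 0" and y_lim: "(y \<longlongrightarrow> 0) at_top"
    and x_der: "\<forall>\<^sub>F t in at_top. (x has_real_derivative - f (x t) + g t) (at t)"
    and G_der: "\<forall>\<^sub>F t in at_top. (G has_real_derivative g t) (at t)"
    and x_lim: "(x \<longlongrightarrow> 0) at_top"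
    and profile: "((\<lambda>t. x t / y t) \<longlongrightarrow> l) at_top"
  shows "\<exists>L. (G \<longlongrightarrow> L) at_top \<and> ((\<lambda>t. (L - G t) / y t) \<longlongrightarrow> 0) at_top"
proof -
  have y_right: "filterlim y (at_right 0) at_top"
    using y_lim y_pos by (auto simp: filterlim_at elim: eventually_mono)
  have "((\<lambda>t. f (y t * (x t / y t)) / f (y t)) \<longlongrightarrow> l) at_top"
    using filterlim_compose[OF quot filterlim_Pair[OF y_right profile]] by simp
  moreover have "\<forall>\<^sub>F t in at_top. f (y t * (x t / y t)) / f (y t) = f (x t) / f (y t)"
    using y_pos by eventually_elim simp
  ultimately have f_quot: "((\<lambda>t. f (x t) / f (y t)) \<longlongrightarrow> l) at_top"
    by (rule Lim_transform_eventually)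
  have H_der: "\<forall>\<^sub>F t in at_top. ((\<lambda>t. G t - x t) has_real_derivative f (x t)) (at t)"
    using x_der G_der by eventually_elim (auto intro!: derivative_eq_intros)
  have fy_pos: "\<forall>\<^sub>F t in at_top. f (y t) > 0" using y_pos by eventually_elim (rule f_pos)
  obtain L where L: "((\<lambda>t. G t - x t) \<longlongrightarrow> L) at_top"
      "((\<lambda>t. (L - (G t - x t)) / y t) \<longlongrightarrow> l) at_top"
    using LHospital_at_top_0_over_0[OF H_der y_der y_pos fy_pos y_lim f_quot] by blast
  have "(G \<longlongrightarrow> L) at_top" using tendsto_add[OF L(1) x_lim] by simp
  moreover have "((\<lambda>t. (L - G t) / y t) \<longlongrightarrow> 0) at_top"
    using tendsto_diff[OF L(2) profile] by (simp add: diff_divide_distrib[symmetric])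
  ultimately show ?thesis by blast
qed

theorem theorem6:
  fixes f \<phi> g x :: "real \<Rightarrow> real" and \<beta> \<xi> :: real
  assumes f_cont: "continuous_on UNIV f"
    and f_zero: "f 0 = 0"
    and f_sign: "\<And>y. y \<noteq> 0 \<Longrightarrow> y * f y > 0"
    and phi_odd: "\<And>y. \<phi> (- y) = - \<phi> y"
    and f_phi: "((\<lambda>y. f y / \<phi> y) \<longlongrightarrow> 1) (at 0)"
    and beta: "\<beta> > 1"
    and f_RV: "regularly_varying_at_0 f \<beta>"
    and f_small: "((\<lambda>y. f y / y) \<longlongrightarrow> 0) (at_right 0)"
    and g_cont: "continuous_on {0..} g"
    and x_cont: "continuous_on {0..} x"
    and x_ode: "\<And>t. t > 0 \<Longrightarrow> (x has_real_derivative (- f (x t) + g t)) (at t)"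
    and x_init: "x 0 = \<xi>"
    and x_lim: "(x \<longlongrightarrow> 0) at_top"
  shows "((\<exists>L. ((\<lambda>t. LBINT s=0..ereal t. g s) \<longlongrightarrow> L) at_top) \<and>
          ((\<lambda>t. tail_integral g t / F_inv f t) \<longlongrightarrow> 0) at_top)
     \<longleftrightarrow> (\<exists>l\<in>{-1, 0, 1}. ((\<lambda>t. x t / F_inv f t) \<longlongrightarrow> l) at_top)"
proof -
  define G where "G t = (LBINT s=0..ereal t. g s)" for t
  have f_pos: "f u > 0" if "u > 0" for u
    using f_sign[of u] that by (simp add: zero_less_mult_iff)
  have cont: "continuous_on {0<..} f" using f_cont by (rule continuous_on_subset) simp
  note y = F_inv_solves_ode[OF cont f_pos f_small]
  have y_pos: "\<forall>\<^sub>F t in at_top. F_inv f t > 0"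
    using eventually_ge_at_top[of 0] by eventually_elim (rule y(1))
  have y_der: "\<forall>\<^sub>F t in at_top. (F_inv f has_real_derivative - f (F_inv f t)) (at t)"
    using eventually_gt_at_top[of 0] by eventually_elim (rule y(2))
  have x_der: "\<forall>\<^sub>F t in at_top. (x has_real_derivative - f (x t) + g t) (at t)"
    using eventually_gt_at_top[of 0] by eventually_elim (rule x_ode)
  have G_der: "\<forall>\<^sub>F t in at_top. (G has_real_derivative g t) (at t)"
    using eventually_gt_at_top[of 0]
  proof eventually_elim
    case (elim t)
    then show ?case
      using LBINT_has_real_derivative[OF g_cont, of 0 "t + 1" 0 t]
      unfolding G_def zero_ereal_def by auto
  qed
  have odd: "((\<lambda>y. f (- y) / f y) \<longlongrightarrow> - 1) (at 0)"
    using asymptotically_odd[OF phi_odd f_phi] .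
  note quot = RV_quotient_tendsto[OF f_RV cont beta f_zero odd]
  note growth = RV_quotient_growth[OF f_RV cont beta odd]
  have tail: "tail_integral g t = L - G t" if "(G \<longlongrightarrow> L) at_top" for L t
    using tendsto_Lim[OF _ that] unfolding tail_integral_def G_def by simp
  have "((\<exists>L. (G \<longlongrightarrow> L) at_top) \<and> ((\<lambda>t. tail_integral g t / F_inv f t) \<longlongrightarrow> 0) at_top)
     \<longleftrightarrow> (\<exists>l\<in>{-1, 0, 1}. ((\<lambda>t. x t / F_inv f t) \<longlongrightarrow> l) at_top)" (is "?a \<longleftrightarrow> ?b")
  proof
    assume ?a
    then obtain L where "(G \<longlongrightarrow> L) at_top" "((\<lambda>t. (L - G t) / F_inv f t) \<longlongrightarrow> 0) at_top"
      using tail by auto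
    then show ?b
      using small_tail_imp_asymptotic_profile[OF beta f_pos quot growth y_der y_pos y(3) x_der G_der x_lim]
      by blast
  next
    assume ?b
    then obtain l where l: "l \<in> {-1, 0, 1}" "((\<lambda>t. x t / F_inv f t) \<longlongrightarrow> l) at_top" by blast
    then have "signed_power \<beta> l = l" using signed_power_fixed_point_iff[OF beta] by blast
    then obtain L where L: "(G \<longlongrightarrow> L) at_top" "((\<lambda>t. (L - G t) / F_inv f t) \<longlongrightarrow> 0) at_top"
      using asymptotic_profile_imp_small_tail[OF f_pos _ y_der y_pos y(3) x_der G_der x_lim l(2)]
        quot[of l] by auto
    then show ?a using tail[OF L(1)] by auto
  qed
  then show ?thesis unfolding G_def .
qed

end
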